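(* Let $g_1,\dots,g_m:\mathbb{R}^n\to\mathbb{R}$ be continuously differentiable, let $G(x)=\mathrm{Diag}(g_1(x),\dots,g_m(x))$ be the associated diagonal matrix function, and let $\bar x\in\mathbb{R}^n$ satisfy $g_1(\bar x)\ge0,\dots,g_m(\bar x)\ge0$. Let $\mathcal{A}(\bar x)=\{i\in\{1,\dots,m\}: g_i(\bar x)=0\}$. Then the following statements are equivalent: 1. weak-CPLD (for the constraint $G(x)\succeq0$) holds at $\bar x$; 2. for every $J\subseteq\mathcal{A}(\bar x)$, if the family $\{\nabla g_i(\bar x)\}_{i\in J}$ is positively linearly dependent, then the family $\{\nabla g_i(x)\}_{i\in J}$ is linearly dependent for every $x$ close enough to $\bar x$.
   Context: $\mathbb{S}^m$ is the space of real symmetric $m\times m$ matrices; $M\succeq 0$ means $M$ is positive semidefinite. $D_{x_i}G(x)$ is the $i$-th partial derivative of $G:\mathbb{R}^n\to\mathbb{S}^m$. Eigenvalues of $M\in\mathbb{S}^m$ are ordered $\lambda_1(M)\ge\dots\ge\lambda_m(M)$. For $0\le r<m$, $\mathcal{E}_r(M)$ is the set of $E\in\mathbb{R}^{m\times(m-r)}$ with $E^\top E=I_{m-r}$ and $ME=E\,\mathrm{Diag}(\lambda_{r+1}(M),\dots,\lambda_m(M))$. For $E$ with columns $e_1,\dots,e_{m-r}$, $v_{ii}(x,E)=[e_i^\top D_{x_1}G(x)e_i,\dots,e_i^\top D_{x_n}G(x)e_i]^\top\in\mathbb{R}^n$. A finite family $\{z_i\}_{i\in J}$ is positively linearly dependent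 if there are $\alpha_i\ge0$, $i \in J$, not all zero, with $\sum_{i\in J}\alpha_iz_i=0$. Weak-CPLD at $\bar x$ with $G(\bar x)\succeq0$ and $r=\mathrm{rank}\,G(\bar x)$: either $r=m$ or, for each sequence $x^k\to\bar x$, there exist an infinite set $I\subseteq\mathbb{N}$ and matrices $E^k\in\mathcal{E}_r(G(x^k))$, $k\in I$, with $\{E^k\}_{k\in I}$ convergent to some $\bar E$, such that for every $J\subseteq\{1,\dots,m-r\}$: if the family $\{v_{ii}(\bar x,\bar E)\}_{i\in J}$ is positively linearly dependent, then the family $\{v_{ii}(x^k,E^k)\}_{i\in J}$ is linearly dependent for all sufficiently large $k\in I$. *)

theory Defs
  imports
    "HOL-Analysis.Analysis"
    "HOL-Computational_Algebra.Computational_Algebra"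
begin

definition diag_matrix :: "('m::finite \<Rightarrow> real) \<Rightarrow> real ^ 'm ^ 'm" where
  "diag_matrix d = (\<chi> i j. if i = j then d i else 0)"

definition psd :: "real ^ 'm ^ 'm \<Rightarrow> bool" where
  "psd M \<longleftrightarrow> transpose M = M \<and> (\<forall>u. 0 \<le> u \<bullet> (M *v u))"

definition charpoly :: "real ^ 'm ^ 'm \<Rightarrow> real poly" where
  "charpoly M = det (mat [:0, 1:] - map_matrix (\<lambda>a. [:a:]) M)"

text \<open>Eigenvalues are counted with multiplicity and listed in decreasing order; the index is
  1-based, so for symmetric \<open>M\<close> it ranges over \<open>{1..CARD('m)}\<close>.\<close>

definition eigval :: "real ^ 'm ^ 'm \<Rightarrow> nat \<Rightarrow> real" where
  "eigval M i = rev (sorted_list_of_multiset (proots (charpoly M))) ! (i - 1)"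

text \<open>An \<open>m \<times> (m - r)\<close> matrix is represented by its columns \<open>E 1, \<dots>, E (m - r)\<close>, since \<open>r\<close>
  is not known at the level of types; values of \<open>E\<close> at other indices are irrelevant.
  The two clauses are the columnwise reading of \<open>E\<^sup>T E = I\<close> and
  \<open>M E = E Diag (\<lambda>\<^bsub>r+1\<^esub>, \<dots>, \<lambda>\<^bsub>m\<^esub>)\<close>.\<close>

definition eigmats :: "nat \<Rightarrow> real ^ 'm ^ 'm \<Rightarrow> (nat \<Rightarrow> real ^ 'm) set" where
  "eigmats r M = {E.
     (\<forall>i\<in>{1..CARD('m) - r}. \<forall>j\<in>{1..CARD('m) - r}. E i \<bullet> E j = (if i = j then 1 else 0)) \<and>
     (\<forall>i\<in>{1..CARD('m) - r}. M *v E i = eigval M (r + i) *\<^sub>R E i)}"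

definition partial_deriv ::
    "'n::finite \<Rightarrow> (real ^ 'n \<Rightarrow> 'b::real_normed_vector) \<Rightarrow> real ^ 'n \<Rightarrow> 'b" where
  "partial_deriv l F x = vector_derivative (\<lambda>t. F (x + t *\<^sub>R axis l 1)) (at 0)"

definition vdiag ::
    "(real ^ 'n \<Rightarrow> real ^ 'm ^ 'm) \<Rightarrow> real ^ 'n \<Rightarrow> (nat \<Rightarrow> real ^ 'm) \<Rightarrow> nat \<Rightarrow> real ^ 'n" where
  "vdiag G x E i = (\<chi> l. E i \<bullet> (partial_deriv l G x *v E i))"

text \<open>Dependence of indexed families, not of sets of vectors: repeated vectors count separately.\<close>

definition lin_dep_family :: "'i set \<Rightarrow> ('i \<Rightarrow> 'a::real_vector) \<Rightarrow> bool" where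
  "lin_dep_family J z \<longleftrightarrow> finite J \<and>
     (\<exists>\<alpha>. (\<exists>i\<in>J. \<alpha> i \<noteq> 0) \<and> (\<Sum>i\<in>J. \<alpha> i *\<^sub>R z i) = 0)"

definition pos_lin_dep_family :: "'i set \<Rightarrow> ('i \<Rightarrow> 'a::real_vector) \<Rightarrow> bool" where
  "pos_lin_dep_family J z \<longleftrightarrow> finite J \<and>
     (\<exists>\<alpha>. (\<forall>i\<in>J. 0 \<le> \<alpha> i) \<and> (\<exists>i\<in>J. \<alpha> i \<noteq> 0) \<and> (\<Sum>i\<in>J. \<alpha> i *\<^sub>R z i) = 0)"

text \<open>The filter \<open>inf sequentially (principal I)\<close> is that of \<open>k \<rightarrow> \<infinity>\<close> with \<open>k \<in> I\<close>.\<close>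

definition weak_CPLD :: "(real ^ 'n \<Rightarrow> real ^ 'm ^ 'm) \<Rightarrow> real ^ 'n \<Rightarrow> bool" where
  "weak_CPLD G xbar \<longleftrightarrow> psd (G xbar) \<and>
     (let r = rank (G xbar) in
       r = CARD('m) \<or>
       (\<forall>x. x \<longlonglongrightarrow> xbar \<longrightarrow>
         (\<exists>I E Ebar. infinite I \<and>
            (\<forall>k\<in>I. E k \<in> eigmats r (G (x k))) \<and>
            (\<forall>i\<in>{1..CARD('m) - r}.
               ((\<lambda>k. E k i) \<longlongrightarrow> Ebar i) (inf sequentially (principal I))) \<and>
            (\<forall>J\<subseteq>{1..CARD('m) - r}.
               pos_lin_dep_family J (vdiag G xbar Ebar) \<longrightarrow>
               (\<forall>\<^sub>F k in inf sequentially (principal I).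
                  lin_dep_family J (vdiag G (x k) (E k)))))))"

end

theory Submission
  imports Defs
begin

text \<open>
  If the eigenvalues of \<open>G(x)\<close> are simple, the eigenvectors are standard basis vectors and the
  \<open>v\<^sub>i\<^sub>i\<close> are gradients of the \<open>g\<^sub>j\<close>; in general \<open>v\<^sub>i\<^sub>i\<close> is a convex combination of
  gradients of those \<open>g\<^sub>j\<close> that share a common value at \<open>x\<close>.

  For (2) implies (1), enumerate the diagonal entries of \<open>G(x\<^sup>k)\<close> in decreasing order, pass to a
  subsequence on which the enumeration is constant, and take standard basis vectors for \<open>E\<^sup>k\<close>.

  For (1) implies (2), suppose that the gradients over \<open>J\<close> are linearly independent at points
  arbitrarily close to \<open>xbar\<close>. Linear independence is an open condition, and each nonempty open set
  contains points at which any tie \<open>g\<^sub>i = g\<^sub>j\<close> persists in a neighbourhood. At such a point tied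
  functions have equal gradients, so \<open>v\<^sub>i\<^sub>i\<close> is a single gradient whatever eigenvectors are chosen.
  A sequence of such points contradicts weak-CPLD, again after making the enumeration constant.
\<close>

section \<open>Rank, semidefiniteness and spectrum of a diagonal matrix\<close>

lemma diag_matrix_mult_vec: "diag_matrix d *v u = (\<chi> i. d i * u $ i)"
  by (simp add: diag_matrix_def matrix_vector_mult_def vec_eq_iff if_distrib [of "\<lambda>c. c * _"]
      cong: if_cong)

lemma inner_diag_matrix_mult_vec:
  "u \<bullet> (diag_matrix d *v u) = (\<Sum>i\<in>UNIV. d i * (u $ i)\<^sup>2)"
  by (simp add: diag_matrix_mult_vec inner_vec_def power2_eq_square mult_ac)

lemma psd_diag_matrix:
  assumes "\<And>i. 0 \<le> d i"
  shows "psd (diag_matrix d)"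
  unfolding psd_def inner_diag_matrix_mult_vec using assms
  by (auto simp: diag_matrix_def transpose_def vec_eq_iff intro!: sum_nonneg)

lemma rank_diag_matrix: "rank (diag_matrix d) = card {i. d i \<noteq> 0}"
proof -
  have "range (\<lambda>x. diag_matrix d *v x) = {x. \<forall>i. i \<notin> {i. d i \<noteq> 0} \<longrightarrow> x $ i = 0}"
  proof (intro equalityI subsetI)
    fix y :: "real ^ 'a"
    assume "y \<in> {x. \<forall>i. i \<notin> {i. d i \<noteq> 0} \<longrightarrow> x $ i = 0}"
    \<comment> \<open>Where \<open>d i = 0\<close> the quotient is \<open>0\<close> by the
      convention for division, and \<open>y $ i = 0\<close> there as well.\<close>
    then have "y = diag_matrix d *v (\<chi> i. y $ i / d i)"
      by (simp add: diag_matrix_mult_vec vec_eq_iff)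
    then show "y \<in> range (\<lambda>x. diag_matrix d *v x)"
      by blast
  qed (auto simp: diag_matrix_mult_vec)
  then show ?thesis
    using dim_substandard_cart [of "{i. d i \<noteq> 0}", where 'a = real]
    by (simp add: rank_dim_range dim_vec_eq)
qed

text \<open>The matrix whose determinant is taken is itself diagonal, so the characteristic
  polynomial splits into the linear factors \<open>[:- d i, 1:]\<close>, one for each index; hence
  the roots carry their multiplicities.\<close>

lemma proots_charpoly_diag_matrix:
  "proots (charpoly (diag_matrix d)) = image_mset d (mset_set UNIV)"
proof -
  have "charpoly (diag_matrix d) = (\<Prod>i\<in>UNIV. [:- d i, 1:])"
    unfolding charpoly_def
    by (subst det_diagonal) (auto simp: mat_def diag_matrix_def map_matrix_def)
  then show ?thesis
    by (simp add: proots_prod sum_unfold_sum_mset)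
qed

text \<open>Indices are enumerated rather than values: this makes it possible to attach to each
  eigenvalue a particular function \<open>g j\<close>. Equal entries may come in either
  order.\<close>

lemma eigval_diag_matrix:
  fixes d :: "'m::finite \<Rightarrow> real"
  obtains xs where "distinct xs" "set xs = UNIV" "sorted_wrt (\<lambda>i j. d j \<le> d i) xs"
    "\<And>i. i \<in> {1..CARD('m)} \<Longrightarrow> eigval (diag_matrix d) i = d (xs ! (i - 1))"
proof -
  obtain zs :: "'m list" where zs: "set zs = UNIV" "distinct zs"
    using finite_distinct_list [of "UNIV :: 'm set"] by auto
  define ys where "ys = sort_key d zs"
  have ys: "set ys = UNIV" "distinct ys" "sorted (map d ys)"
    using zs by (simp_all add: ys_def)
  have "mset (map d ys) = image_mset d (mset_set UNIV)"
    using ys by (metis mset_map mset_set_set)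
  then have "sorted_list_of_multiset (proots (charpoly (diag_matrix d))) = map d ys"
    by (metis proots_charpoly_diag_matrix sorted_list_of_multiset_mset sorted_sort_id ys(3))
  moreover have "length ys = CARD('m)"
    using ys by (metis distinct_card)
  ultimately have "eigval (diag_matrix d) i = d (rev ys ! (i - 1))" if "i \<in> {1..CARD('m)}" for i
    using that by (auto simp: eigval_def rev_map intro!: nth_map)
  then show ?thesis
    using ys that [of "rev ys"] by (simp add: sorted_wrt_rev sorted_map)
qed

text \<open>Entries over \<open>A\<close> are strictly below all others, so a decreasing list puts
  the other \<open>r\<close> indices first and leaves exactly \<open>A\<close> for the tail. It is
  applied with \<open>A\<close> the active indices, where \<open>r\<close> is the rank at
  \<open>xbar\<close>.\<close>

lemma bij_betw_tail_of_decreasing_enumeration: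
  fixes d :: "'m::finite \<Rightarrow> real"
  assumes xs: "distinct xs" "set xs = UNIV" "sorted_wrt (\<lambda>i j. d j \<le> d i) xs"
    and r: "r = card (- A)"
    and less: "\<And>a b. a \<in> A \<Longrightarrow> b \<notin> A \<Longrightarrow> d a < d b"
  shows "bij_betw (\<lambda>i. xs ! (r + i - 1)) {1..CARD('m) - r} A"
proof -
  have len: "length xs = CARD('m)"
    using xs by (metis distinct_card)
  have "card A + card (- A) = CARD('m)"
    by (metis Compl_partition Compl_disjoint card_Un_disjoint finite)
  then have cardA: "card A = CARD('m) - r" and "r \<le> CARD('m)"
    using r by simp_all
  let ?s = "\<lambda>i. xs ! (r + i - 1)"
  have inj: "inj_on ?s {1..CARD('m) - r}"
    using xs(1) len by (auto simp: inj_on_def nth_eq_iff_index_eq)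
  have sub: "?s ` {1..CARD('m) - r} \<subseteq> A"
  proof
    fix t
    assume "t \<in> ?s ` {1..CARD('m) - r}"
    then obtain i where i: "i \<in> {1..CARD('m) - r}" "t = xs ! (r + i - 1)"
      by blast
    define p where "p = r + i - 1"
    have p: "r \<le> p" "p < CARD('m)" "t = xs ! p"
      using i by (auto simp: p_def)
    show "t \<in> A"
    proof (rule ccontr)
      assume "t \<notin> A"
      \<comment> \<open>An index outside \<open>A\<close> at position \<open>p\<close> would push
        all of \<open>A\<close> strictly behind \<open>p\<close>. Since \<open>r \<le> p\<close>,
        fewer than \<open>CARD('m) - r\<close> positions remain there, too few for
        \<open>A\<close>.\<close>
      have "A \<subseteq> (!) xs ` {p<..<CARD('m)}"
      proof
        fix a
        assume "a \<in> A"
        obtain q where q: "q < CARD('m)" "a = xs ! q"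
          using xs(2) len by (metis UNIV_I in_set_conv_nth)
        have "p < q"
        proof (rule ccontr)
          assume "\<not> p < q"
          then have "q = p \<or> q < p"
            by auto
          then have "d t \<le> d a"
            using sorted_wrt_nth_less [OF xs(3), of q p] p q len by auto
          then show False
            using less [OF \<open>a \<in> A\<close> \<open>t \<notin> A\<close>] by simp
        qed
        then show "a \<in> (!) xs ` {p<..<CARD('m)}"
          using q by auto
      qed
      then have "card A \<le> card {p<..<CARD('m)}"
        by (rule surj_card_le [rotated]) simp
      then show False
        using cardA p by simp
    qed
  qed
  have "?s ` {1..CARD('m) - r} = A"
    by (rule card_subset_eq [OF _ sub]) (use card_image [OF inj] cardA in simp_all)
  then show ?thesis
    using inj by (simp add: bij_betw_def)
qed

section \<open>Derivatives of a diagonal matrix function\<close>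

lemma has_vector_derivative_diag_matrix:
  fixes f :: "'m::finite \<Rightarrow> real \<Rightarrow> real"
  assumes "\<And>i. (f i has_vector_derivative f' i) F"
  shows "((\<lambda>t. diag_matrix (\<lambda>i. f i t)) has_vector_derivative diag_matrix f') F"
proof -
  \<comment> \<open>\<open>?L i c\<close> has \<open>c\<close> at position \<open>(i, i)\<close> and
    zeros elsewhere. A diagonal matrix is thus a combination of constant matrices with scalar
    coefficients, and can be differentiated term by term.\<close>
  let ?L = "\<lambda>i c. axis i (axis i c) :: real ^ 'm ^ 'm"
  have diag: "diag_matrix h = (\<Sum>i\<in>UNIV. h i *\<^sub>R ?L i 1)" for h :: "'m \<Rightarrow> real"
    by (auto simp: vec_eq_iff diag_matrix_def axis_def if_distrib if_distribR cong: if_cong)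
  show ?thesis
    unfolding diag using assms
    by (auto intro!: derivative_eq_intros simp: has_vector_derivative_def scaleR_sum_right)
qed

lemma partial_deriv_diag_matrix:
  fixes g :: "'m::finite \<Rightarrow> real ^ 'n \<Rightarrow> real"
  assumes "\<And>i. GDERIV (g i) x :> D i"
  shows "partial_deriv l (\<lambda>x. diag_matrix (\<lambda>i. g i x)) x = diag_matrix (\<lambda>i. D i $ l)"
proof -
  have "((\<lambda>t. g i (x + t *\<^sub>R axis l 1)) has_vector_derivative D i $ l) (at 0)" for i
  proof -
    have "(g i has_derivative (\<lambda>h. h \<bullet> D i)) (at (x + 0 *\<^sub>R axis l 1))"
      using assms by (simp add: gderiv_def)
    moreover have "((\<lambda>t. x + t *\<^sub>R axis l 1) has_derivative (\<lambda>t. t *\<^sub>R axis l 1)) (at 0)"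
      by (auto intro!: derivative_eq_intros)
    ultimately have "((\<lambda>t. g i (x + t *\<^sub>R axis l 1)) has_derivative
        (\<lambda>t. (t *\<^sub>R axis l 1) \<bullet> D i)) (at 0)"
      by (rule has_derivative_compose [rotated])
    then show ?thesis
      by (simp add: has_vector_derivative_def inner_axis')
  qed
  then show ?thesis
    unfolding partial_deriv_def
    by (intro vector_derivative_at has_vector_derivative_diag_matrix)
qed

text \<open>The quadratic form of a diagonal matrix sees a column only through its squared entries,
  which become the weights of the gradients; for a unit column they sum to 1.\<close>

lemma vdiag_diag_matrix:
  fixes g :: "'m::finite \<Rightarrow> real ^ 'n \<Rightarrow> real"
  assumes "\<And>i. GDERIV (g i) x :> D i"
  shows "vdiag (\<lambda>x. diag_matrix (\<lambda>i. g i x)) x E i = (\<Sum>j\<in>UNIV. (E i $ j)\<^sup>2 *\<^sub>R D j)"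
  by (simp add: vdiag_def partial_deriv_diag_matrix [OF assms] inner_diag_matrix_mult_vec
      vec_eq_iff mult.commute)

section \<open>Dependence of families: reindexing and closedness\<close>

lemma lin_dep_family_reindex:
  assumes "bij_betw s J' J"
  shows "lin_dep_family J' (\<lambda>i. z (s i)) \<longleftrightarrow> lin_dep_family J z"
proof -
  have J: "J = s ` J'" and inj: "inj_on s J'" and fin: "finite J' \<longleftrightarrow> finite J"
    using assms by (auto simp: bij_betw_def bij_betw_finite finite_image_iff)
  have "\<exists>\<beta>. (\<exists>i\<in>J. \<beta> i \<noteq> 0) \<and> (\<Sum>i\<in>J. \<beta> i *\<^sub>R z i) = 0"
    if "\<exists>i\<in>J'. \<alpha> i \<noteq> 0" "(\<Sum>i\<in>J'. \<alpha> i *\<^sub>R z (s i)) = 0" for \<alpha> :: "'a \<Rightarrow> real"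
    \<comment> \<open>Coefficients are carried over along the inverse of \<open>s\<close> on
      \<open>J'\<close>.\<close>
    using that by (intro exI [of _ "\<lambda>j. \<alpha> (the_inv_into J' s j)"])
      (auto simp: J sum.reindex [OF inj] the_inv_into_f_f [OF inj])
  moreover have "\<exists>\<alpha>. (\<exists>i\<in>J'. \<alpha> i \<noteq> 0) \<and> (\<Sum>i\<in>J'. \<alpha> i *\<^sub>R z (s i)) = 0"
    if "\<exists>i\<in>J. \<beta> i \<noteq> 0" "(\<Sum>i\<in>J. \<beta> i *\<^sub>R z i) = 0" for \<beta> :: "'b \<Rightarrow> real"
    using that by (intro exI [of _ "\<lambda>i. \<beta> (s i)"]) (auto simp: J sum.reindex [OF inj])
  ultimately show ?thesis
    unfolding lin_dep_family_def fin by blast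
qed

lemma pos_lin_dep_family_reindex:
  assumes "bij_betw s J' J"
  shows "pos_lin_dep_family J' (\<lambda>i. z (s i)) \<longleftrightarrow> pos_lin_dep_family J z"
proof -
  have J: "J = s ` J'" and inj: "inj_on s J'" and fin: "finite J' \<longleftrightarrow> finite J"
    using assms by (auto simp: bij_betw_def bij_betw_finite finite_image_iff)
  have "\<exists>\<beta>. (\<forall>i\<in>J. 0 \<le> \<beta> i) \<and> (\<exists>i\<in>J. \<beta> i \<noteq> 0) \<and> (\<Sum>i\<in>J. \<beta> i *\<^sub>R z i) = 0"
    if "\<forall>i\<in>J'. 0 \<le> \<alpha> i" "\<exists>i\<in>J'. \<alpha> i \<noteq> 0" "(\<Sum>i\<in>J'. \<alpha> i *\<^sub>R z (s i)) = 0" for \<alpha> :: "'a \<Rightarrow> real"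
    using that by (intro exI [of _ "\<lambda>j. \<alpha> (the_inv_into J' s j)"])
      (auto simp: J sum.reindex [OF inj] the_inv_into_f_f [OF inj])
  moreover have "\<exists>\<alpha>. (\<forall>i\<in>J'. 0 \<le> \<alpha> i) \<and> (\<exists>i\<in>J'. \<alpha> i \<noteq> 0) \<and> (\<Sum>i\<in>J'. \<alpha> i *\<^sub>R z (s i)) = 0"
    if "\<forall>i\<in>J. 0 \<le> \<beta> i" "\<exists>i\<in>J. \<beta> i \<noteq> 0" "(\<Sum>i\<in>J. \<beta> i *\<^sub>R z i) = 0" for \<beta> :: "'b \<Rightarrow> real"
    using that by (intro exI [of _ "\<lambda>i. \<beta> (s i)"]) (auto simp: J sum.reindex [OF inj])
  ultimately show ?thesis
    unfolding pos_lin_dep_family_def fin by blast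
qed

lemma lin_dep_family_cong:
  "(\<And>i. i \<in> J \<Longrightarrow> z i = w i) \<Longrightarrow> lin_dep_family J z \<longleftrightarrow> lin_dep_family J w"
  by (simp add: lin_dep_family_def)

lemma pos_lin_dep_family_cong:
  "(\<And>i. i \<in> J \<Longrightarrow> z i = w i) \<Longrightarrow> pos_lin_dep_family J z \<longleftrightarrow> pos_lin_dep_family J w"
  by (simp add: pos_lin_dep_family_def)

text \<open>Coefficients can be scaled to the unit sphere. The dependent points are then the
  projection of a closed set along a compact factor, hence closed; so independence is an open
  condition.\<close>

lemma closed_lin_dep_family:
  fixes z :: "'m::finite \<Rightarrow> 'a::euclidean_space \<Rightarrow> 'b::real_normed_vector"
  assumes "\<And>i. continuous_on UNIV (z i)"
  shows "closed {x. lin_dep_family J (\<lambda>i. z i x)}"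
proof -
  define S :: "(real ^ 'm) set" where "S = sphere 0 1 \<inter> (\<Inter>i\<in>-J. {a. a $ i = 0})"
  define T :: "((real ^ 'm) \<times> 'a) set" where "T = {p. (\<Sum>i\<in>J. fst p $ i *\<^sub>R z i (snd p)) = 0}"
  have "compact S"
    unfolding S_def
    by (intro compact_Int_closed closed_INT ballI closed_Collect_eq continuous_intros) auto
  moreover have "closed T"
    unfolding T_def
    by (intro closed_Collect_eq continuous_intros continuous_on_compose2 [OF assms]) auto
  moreover have "lin_dep_family J (\<lambda>i. z i x) \<longleftrightarrow> (\<exists>a. a \<in> S \<and> (a, x) \<in> T)" for x
  proof
    assume "lin_dep_family J (\<lambda>i. z i x)"
    then obtain \<alpha> j where \<alpha>: "j \<in> J" "\<alpha> j \<noteq> 0" "(\<Sum>i\<in>J. \<alpha> i *\<^sub>R z i x) = 0"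
      by (auto simp: lin_dep_family_def)
    \<comment> \<open>Extension by zero outside \<open>J\<close> lets one fixed coefficient space
      serve every \<open>J\<close>; dividing by the norm brings \<open>b\<close> into
      \<open>S\<close>.\<close>
    define b :: "real ^ 'm" where "b = (\<chi> i. if i \<in> J then \<alpha> i else 0)"
    have "b \<noteq> 0"
      using \<alpha> by (auto simp: b_def vec_eq_iff)
    have "(\<Sum>i\<in>J. (b /\<^sub>R norm b) $ i *\<^sub>R z i x) = (\<Sum>i\<in>J. \<alpha> i *\<^sub>R z i x) /\<^sub>R norm b"
      by (simp add: b_def scaleR_sum_right)
    then have "b /\<^sub>R norm b \<in> S \<and> (b /\<^sub>R norm b, x) \<in> T"
      using \<open>b \<noteq> 0\<close> \<alpha>(3) by (simp add: S_def T_def) (simp add: b_def)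
    then show "\<exists>a. a \<in> S \<and> (a, x) \<in> T"
      by blast
  next
    assume "\<exists>a. a \<in> S \<and> (a, x) \<in> T"
    then obtain a where a: "norm a = 1" "\<And>i. i \<notin> J \<Longrightarrow> a $ i = 0"
        "(\<Sum>i\<in>J. a $ i *\<^sub>R z i x) = 0"
      by (auto simp: S_def T_def)
    have "\<exists>i\<in>J. a $ i \<noteq> 0"
    proof (rule ccontr)
      assume "\<not> ?thesis"
      then have "a = 0"
        using a(2) by (metis vec_eq_iff zero_index)
      then show False
        using a(1) by simp
    qed
    then show "lin_dep_family J (\<lambda>i. z i x)"
      unfolding lin_dep_family_def using a(3) by auto
  qed
  ultimately show ?thesis
    using closed_compact_projection [of S T] by simp
qed

section \<open>Persistent ties and equality of gradients\<close>

text \<open>The finitely many pairs are treated one by one. Either a pair is tied on all of the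
  current open set, or the set shrinks to its nonempty open part where the pair differs. In the end
  each pair is tied everywhere or nowhere on the set, and any of its points will do.\<close>

lemma exists_point_ties_locally_constant:
  fixes g :: "'m::finite \<Rightarrow> 'a::topological_space \<Rightarrow> 'b::t2_space"
  assumes cont: "\<And>i. continuous_on UNIV (g i)" and "open U" "U \<noteq> {}"
  obtains x where "x \<in> U" "\<And>i j. g i x = g j x \<Longrightarrow> \<forall>\<^sub>F y in nhds x. g i y = g j y"
proof -
  have "\<exists>V. open V \<and> V \<noteq> {} \<and> V \<subseteq> U \<and>
      (\<forall>(i, j)\<in>P. (\<forall>x\<in>V. g i x \<noteq> g j x) \<or> (\<forall>x\<in>V. g i x = g j x))"
    if "finite P" for P :: "('m \<times> 'm) set"
    using that
  proof induction
    case empty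
    then show ?case
      using assms by blast
  next
    case (insert p P)
    then obtain V where V: "open V" "V \<noteq> {}" "V \<subseteq> U"
        "\<forall>(i, j)\<in>P. (\<forall>x\<in>V. g i x \<noteq> g j x) \<or> (\<forall>x\<in>V. g i x = g j x)"
      by blast
    obtain i j where p: "p = (i, j)"
      by (cases p)
    show ?case
    proof (cases "\<forall>x\<in>V. g i x = g j x")
      case True
      then show ?thesis
        using V p by (intro exI [of _ V]) simp
    next
      case False
      have "open (V \<inter> {x. g i x \<noteq> g j x})"
        using V(1) cont by (intro open_Int open_Collect_neq) auto
      then show ?thesis
        using False V p by (intro exI [of _ "V \<inter> {x. g i x \<noteq> g j x}"]) fastforce
    qed
  qed
  from this [of UNIV] obtain V where V: "open V" "V \<noteq> {}" "V \<subseteq> U"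
      "\<And>i j. (\<forall>x\<in>V. g i x \<noteq> g j x) \<or> (\<forall>x\<in>V. g i x = g j x)"
    by auto
  then obtain x where "x \<in> V"
    by blast
  moreover have "\<forall>\<^sub>F y in nhds x. g i y = g j y" if "g i x = g j x" for i j
    using V(1) V(4) [of i j] that \<open>x \<in> V\<close> by (auto simp: eventually_nhds)
  ultimately show ?thesis
    using that V(3) by blast
qed

lemma GDERIV_unique:
  assumes "GDERIV f x :> D" "GDERIV f x :> D'"
  shows "D = D'"
proof -
  have "(\<lambda>h. h \<bullet> D) = (\<lambda>h. h \<bullet> D')"
    using assms unfolding gderiv_def by (rule has_derivative_unique)
  \<comment> \<open>Both functionals are evaluated at \<open>D - D'\<close>.\<close>
  then have "(D - D') \<bullet> D = (D - D') \<bullet> D'"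
    by (rule fun_cong)
  then have "(D - D') \<bullet> (D - D') = 0"
    by (simp add: inner_diff_right)
  then show ?thesis
    by simp
qed

lemma GDERIV_eventually_eq:
  assumes "GDERIV f x :> D" "GDERIV h x :> D'" "\<forall>\<^sub>F y in nhds x. f y = h y"
  shows "D = D'"
proof -
  have "GDERIV h x :> D"
    using assms(1) unfolding gderiv_def
    by (rule has_derivative_transform_eventually)
      (use assms(3) in \<open>auto simp: eventually_at_filter elim: eventually_mono
        dest: eventually_nhds_x_imp_x\<close>)
  then show ?thesis
    using assms(2) GDERIV_unique by blast
qed

section \<open>Eigenvectors and eigenvalues along sequences\<close>

lemma sequentially_within_infinite_neq_bot:
  "infinite I \<Longrightarrow> inf sequentially (principal I) \<noteq> bot"
  unfolding trivial_limit_def eventually_inf_principal eventually_sequentially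
  by (auto simp: infinite_nat_iff_unbounded_le)

text \<open>An eigenvector of a diagonal matrix is supported on the indices whose entry equals its
  eigenvalue \<open>g j x\<close>. These are tied with \<open>j\<close>, so all gradients with
  nonzero weight coincide with \<open>D j\<close>.\<close>

lemma vdiag_eigmats_at_locally_constant_ties:
  fixes g :: "'m::finite \<Rightarrow> real ^ 'n \<Rightarrow> real"
  assumes E: "E \<in> eigmats r (diag_matrix (\<lambda>j. g j x))" and i: "i \<in> {1..CARD('m) - r}"
    and j: "eigval (diag_matrix (\<lambda>j. g j x)) (r + i) = g j x"
    and deriv: "\<And>j. GDERIV (g j) x :> D j"
    and ties: "\<And>i j. g i x = g j x \<Longrightarrow> \<forall>\<^sub>F y in nhds x. g i y = g j y"
  shows "vdiag (\<lambda>x. diag_matrix (\<lambda>i. g i x)) x E i = D j"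
proof -
  have eig: "diag_matrix (\<lambda>j. g j x) *v E i = g j x *\<^sub>R E i" and unit: "E i \<bullet> E i = 1"
    using E i j by (auto simp: eigmats_def)
  have "(E i $ l)\<^sup>2 *\<^sub>R D l = (E i $ l)\<^sup>2 *\<^sub>R D j" for l
  proof (cases "E i $ l = 0")
    case False
    have "g l x * E i $ l = g j x * E i $ l"
      using eig by (simp add: diag_matrix_mult_vec vec_eq_iff)
    then have "D l = D j"
      using False by (intro GDERIV_eventually_eq [OF deriv deriv ties]) simp
    then show ?thesis
      by simp
  qed simp
  then have "vdiag (\<lambda>x. diag_matrix (\<lambda>i. g i x)) x E i = (\<Sum>l\<in>UNIV. (E i $ l)\<^sup>2) *\<^sub>R D j"
    by (simp only: vdiag_diag_matrix [OF deriv] scaleR_sum_left)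
  also have "(\<Sum>l\<in>UNIV. (E i $ l)\<^sup>2) = 1"
    using unit by (simp add: inner_vec_def power2_eq_square)
  finally show ?thesis
    by simp
qed

text \<open>There are finitely many enumerations of the indices, so one of them is decreasing for
  infinitely many \<open>k\<close>. For large \<open>k\<close> the active entries lie strictly below
  the inactive ones, hence its tail beyond position \<open>r\<close> lists exactly the active
  indices.\<close>

lemma subsequence_with_constant_eigval_enumeration:
  fixes g :: "'m::finite \<Rightarrow> 'a::topological_space \<Rightarrow> real"
  assumes cont: "\<And>i. continuous_on UNIV (g i)" and nonneg: "\<And>i. 0 \<le> g i xbar"
    and r: "r = card {i. g i xbar \<noteq> 0}"
    and x: "x \<longlonglongrightarrow> xbar" and I: "infinite I"
  obtains I' s where "I' \<subseteq> I" "infinite I'"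
    "bij_betw s {1..CARD('m) - r} {i. g i xbar = 0}"
    "\<forall>k\<in>I'. \<forall>i\<in>{1..CARD('m) - r}.
       eigval (diag_matrix (\<lambda>i. g i (x k))) (r + i) = g (s i) (x k)"
proof -
  let ?A = "{i. g i xbar = 0}"
  let ?P = "\<lambda>k xs. distinct xs \<and> set xs = UNIV \<and> sorted_wrt (\<lambda>i j. g j (x k) \<le> g i (x k)) xs \<and>
      (\<forall>i\<in>{1..CARD('m)}. eigval (diag_matrix (\<lambda>i. g i (x k))) i = g (xs ! (i - 1)) (x k))"
  have "\<exists>xs. ?P k xs" for k
    by (rule eigval_diag_matrix [of "\<lambda>i. g i (x k)"]) blast
  then obtain xs where xs: "\<And>k. ?P k (xs k)"
    by metis
  have tendsto: "(\<lambda>k. g i (x k)) \<longlonglongrightarrow> g i xbar" for i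
    using continuous_on_tendsto_compose [OF cont x] by simp
  \<comment> \<open>The difference tends to \<open>g b xbar\<close>, which is positive because it is
    nonnegative and \<open>b\<close> is inactive.\<close>
  have "\<forall>\<^sub>F k in sequentially. g a (x k) < g b (x k)" if "a \<in> ?A" "b \<notin> ?A" for a b
    using order_tendstoD(1) [OF tendsto_diff [OF tendsto [of b] tendsto [of a]], of 0]
      that nonneg [of b] by simp
  then have "\<forall>\<^sub>F k in sequentially. \<forall>a\<in>?A. \<forall>b\<in>-?A. g a (x k) < g b (x k)"
    by (intro eventually_ball_finite ballI) auto
  then obtain N where N: "\<And>k a b. k \<ge> N \<Longrightarrow> a \<in> ?A \<Longrightarrow> b \<notin> ?A \<Longrightarrow> g a (x k) < g b (x k)"
    unfolding eventually_sequentially by blast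
  have "I \<subseteq> (I \<inter> {N..}) \<union> {..<N}"
    by auto
  then have "infinite (I \<inter> {N..})"
    using I by (metis finite_Un finite_lessThan finite_subset)
  moreover have "finite (xs ` (I \<inter> {N..}))"
    by (rule finite_subset [OF _ finite_subset_distinct [of UNIV]]) (use xs in auto)
  ultimately obtain k0 where k0: "k0 \<in> I \<inter> {N..}" "infinite {k \<in> I \<inter> {N..}. xs k = xs k0}"
    using pigeonhole_infinite by blast
  show ?thesis
  proof
    show "bij_betw (\<lambda>i. xs k0 ! (r + i - 1)) {1..CARD('m) - r} ?A"
    proof (rule bij_betw_tail_of_decreasing_enumeration)
      show "sorted_wrt (\<lambda>i j. g j (x k0) \<le> g i (x k0)) (xs k0)"
        using xs by blast
      show "r = card (- ?A)"
        using r by (simp add: Collect_neg_eq)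
    qed (use xs N k0 in auto)
    show "\<forall>k\<in>{k \<in> I \<inter> {N..}. xs k = xs k0}. \<forall>i\<in>{1..CARD('m) - r}.
        eigval (diag_matrix (\<lambda>i. g i (x k))) (r + i) = g (xs k0 ! (r + i - 1)) (x k)"
    proof (intro ballI)
      fix k i
      assume k: "k \<in> {k \<in> I \<inter> {N..}. xs k = xs k0}" and i: "i \<in> {1..CARD('m) - r}"
      have "r + i \<in> {1..CARD('m)}"
        using i by auto
      then have "eigval (diag_matrix (\<lambda>i. g i (x k))) (r + i) = g (xs k ! (r + i - 1)) (x k)"
        using xs by blast
      then show "eigval (diag_matrix (\<lambda>i. g i (x k))) (r + i) = g (xs k0 ! (r + i - 1)) (x k)"
        using k by simp
    qed
  qed (use k0 in auto)
qed

section \<open>The equivalence for diagonal constraints\<close>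

theorem corollary3p1:
  fixes g :: "'m::finite \<Rightarrow> real ^ 'n \<Rightarrow> real"
    and grad_g :: "'m \<Rightarrow> real ^ 'n \<Rightarrow> real ^ 'n"
    and xbar :: "real ^ 'n"
  assumes "\<And>i x. GDERIV (g i) x :> grad_g i x"
    and "\<And>i. continuous_on UNIV (grad_g i)"
    and "\<And>i. 0 \<le> g i xbar"
  shows "weak_CPLD (\<lambda>x. diag_matrix (\<lambda>i. g i x)) xbar \<longleftrightarrow>
    (\<forall>J \<subseteq> {i. g i xbar = 0}.
       pos_lin_dep_family J (\<lambda>i. grad_g i xbar) \<longrightarrow>
       (\<forall>\<^sub>F x in nhds xbar. lin_dep_family J (\<lambda>i. grad_g i x)))"
proof -
  define G where "G = (\<lambda>x. diag_matrix (\<lambda>i. g i x))"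
  define r where "r = card {i. g i xbar \<noteq> 0}"
  let ?A = "{i. g i xbar = 0}"
  let ?N = "{1..CARD('m) - r}"
  note deriv = assms(1) and cont_grad = assms(2)
  have cont: "continuous_on UNIV (g i)" for i
    using deriv unfolding gderiv_def
    by (intro continuous_at_imp_continuous_on) (blast intro: has_derivative_continuous)
  have rank: "rank (G xbar) = r"
    by (simp add: G_def r_def rank_diag_matrix)
  have vdiag: "vdiag G y E i = (\<Sum>j\<in>UNIV. (E i $ j)\<^sup>2 *\<^sub>R grad_g j y)" for y E i
    unfolding G_def by (rule vdiag_diag_matrix) (rule deriv)
  have grad_tendsto: "((\<lambda>k. grad_g i (x k)) \<longlongrightarrow> grad_g i xbar) F"
    if "(x \<longlongrightarrow> xbar) F" for i F and x :: "nat \<Rightarrow> real ^ 'n"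
    using continuous_on_tendsto_compose [OF cont_grad that] by simp
  have "weak_CPLD G xbar \<longleftrightarrow>
    (\<forall>J \<subseteq> ?A. pos_lin_dep_family J (\<lambda>i. grad_g i xbar) \<longrightarrow>
       (\<forall>\<^sub>F x in nhds xbar. lin_dep_family J (\<lambda>i. grad_g i x)))" (is "_ \<longleftrightarrow> ?cpld")
  proof
    assume weak: "weak_CPLD G xbar"
    show ?cpld
    proof (intro allI impI, rule ccontr)
      fix J
      assume J: "J \<subseteq> ?A" and pos: "pos_lin_dep_family J (\<lambda>i. grad_g i xbar)"
        and not_ev: "\<not> (\<forall>\<^sub>F x in nhds xbar. lin_dep_family J (\<lambda>i. grad_g i x))"
      \<comment> \<open>A nonempty set of active indices rules out full rank, so the sequence
        alternative of weak-CPLD must hold.\<close>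
      have "J \<noteq> {}"
        using pos by (auto simp: pos_lin_dep_family_def)
      then have "{i. g i xbar \<noteq> 0} \<subset> UNIV"
        using J by blast
      then have "r \<noteq> CARD('m)"
        unfolding r_def by (metis finite psubset_card_mono less_irrefl)
      have "\<exists>y. dist y xbar < inverse (real (Suc k)) \<and> \<not> lin_dep_family J (\<lambda>i. grad_g i y) \<and>
          (\<forall>i j. g i y = g j y \<longrightarrow> (\<forall>\<^sub>F z in nhds y. g i z = g j z))" for k
      proof -
        \<comment> \<open>\<open>?U\<close> is open by closedness of dependence and nonempty by
          \<open>not_ev\<close>, so it contains a point with persistent ties.\<close>
        let ?U = "ball xbar (inverse (real (Suc k))) \<inter> - {y. lin_dep_family J (\<lambda>i. grad_g i y)}"
        have "open ?U"
          using closed_lin_dep_family [OF cont_grad, of J] by (intro open_Int) auto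
        moreover have "?U \<noteq> {}"
        proof
          assume "?U = {}"
          then have "\<forall>y. dist y xbar < inverse (real (Suc k)) \<longrightarrow> lin_dep_family J (\<lambda>i. grad_g i y)"
            unfolding disjoint_iff by (auto simp: dist_commute)
          then show False
            using not_ev by (metis eventually_nhds_metric inverse_positive_iff_positive
                of_nat_0_less_iff zero_less_Suc)
        qed
        ultimately obtain y where "y \<in> ?U"
            "\<And>i j. g i y = g j y \<Longrightarrow> \<forall>\<^sub>F z in nhds y. g i z = g j z"
          by (rule exists_point_ties_locally_constant [where g = g, OF cont]) blast
        then show ?thesis
          by (auto simp: dist_commute)
      qed
      then obtain x where x_dist: "\<And>k. dist (x k) xbar < inverse (real (Suc k))"
        and indep: "\<And>k. \<not> lin_dep_family J (\<lambda>i. grad_g i (x k))"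
        and ties: "\<And>k i j. g i (x k) = g j (x k) \<Longrightarrow> \<forall>\<^sub>F z in nhds (x k). g i z = g j z"
        by metis
      have x: "x \<longlonglongrightarrow> xbar"
      proof (rule metric_tendsto_imp_tendsto [OF LIMSEQ_inverse_real_of_nat])
        have "dist (x k) xbar \<le> dist (inverse (real (Suc k))) 0" for k
          using less_imp_le [OF x_dist [of k]] by simp
        then show "\<forall>\<^sub>F k in sequentially. dist (x k) xbar \<le> dist (inverse (real (Suc k))) 0"
          by (rule always_eventually [OF allI])
      qed
      obtain I E Ebar where IE: "infinite I \<and> (\<forall>k\<in>I. E k \<in> eigmats r (G (x k))) \<and>
          (\<forall>i\<in>?N. ((\<lambda>k. E k i) \<longlongrightarrow> Ebar i) (inf sequentially (principal I))) \<and>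
          (\<forall>K\<subseteq>?N. pos_lin_dep_family K (vdiag G xbar Ebar) \<longrightarrow>
            (\<forall>\<^sub>F k in inf sequentially (principal I). lin_dep_family K (vdiag G (x k) (E k))))"
        using weak x \<open>r \<noteq> CARD('m)\<close> unfolding weak_CPLD_def rank Let_def by blast
      then have I: "infinite I"
        and E: "\<And>k. k \<in> I \<Longrightarrow> E k \<in> eigmats r (G (x k))"
        and Ebar: "\<And>i. i \<in> ?N \<Longrightarrow>
            ((\<lambda>k. E k i) \<longlongrightarrow> Ebar i) (inf sequentially (principal I))"
        by blast+
      obtain I' s where I': "I' \<subseteq> I" "infinite I'" and s: "bij_betw s ?N ?A"
        and eig: "\<forall>k\<in>I'. \<forall>i\<in>?N. eigval (G (x k)) (r + i) = g (s i) (x k)"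
        unfolding G_def
        by (rule subsequence_with_constant_eigval_enumeration
            [where g = g, OF cont assms(3) r_def x I]) blast
      \<comment> \<open>Weak-CPLD speaks about \<open>I\<close>, the fixed enumeration about
        \<open>I'\<close>. As \<open>?F\<close> is finer, limits and eventual dependence along
        \<open>I\<close> pass to it.\<close>
      let ?F = "inf sequentially (principal I')"
      have F: "?F \<noteq> bot" "?F \<le> inf sequentially (principal I)" "?F \<le> sequentially"
        using I'(1) by (simp_all add: sequentially_within_infinite_neq_bot [OF I'(2)] le_infI2)
      have v: "vdiag G (x k) (E k) i = grad_g (s i) (x k)" if "k \<in> I'" "i \<in> ?N" for k i
        unfolding G_def
      proof (rule vdiag_eigmats_at_locally_constant_ties [OF _ that(2) _ deriv ties])
        show "E k \<in> eigmats r (diag_matrix (\<lambda>j. g j (x k)))"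
          using E I'(1) that(1) by (auto simp: G_def)
        show "eigval (diag_matrix (\<lambda>j. g j (x k))) (r + i) = g (s i) (x k)"
          using eig that unfolding G_def by blast
      qed
      \<comment> \<open>By continuity in the point and in the column, both sides are limits of the
        same sequence along \<open>?F\<close>. The vectors \<open>Ebar i\<close> themselves are not
        identified.\<close>
      have vbar: "vdiag G xbar Ebar i = grad_g (s i) xbar" if i: "i \<in> ?N" for i
      proof (rule tendsto_unique [OF F(1)])
        show "((\<lambda>k. vdiag G (x k) (E k) i) \<longlongrightarrow> vdiag G xbar Ebar i) ?F"
          unfolding vdiag
          by (intro tendsto_intros grad_tendsto tendsto_mono [OF F(3) x]
              tendsto_mono [OF F(2) Ebar [OF i]])
        have "\<forall>\<^sub>F k in ?F. grad_g (s i) (x k) = vdiag G (x k) (E k) i"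
          using v i by (auto simp: eventually_inf_principal)
        then show "((\<lambda>k. vdiag G (x k) (E k) i) \<longlongrightarrow> grad_g (s i) xbar) ?F"
          using grad_tendsto [OF tendsto_mono [OF F(3) x]] by (rule Lim_transform_eventually [rotated])
      qed
      \<comment> \<open>\<open>K\<close> collects the eigenvalue positions that \<open>s\<close>
        assigns to the constraints in \<open>J\<close>.\<close>
      obtain K where K: "K \<subseteq> ?N" "bij_betw s K J"
      proof
        show "?N \<inter> s -` J \<subseteq> ?N"
          by blast
        show "bij_betw s (?N \<inter> s -` J) J"
        proof (rule bij_betw_imageI)
          show "inj_on s (?N \<inter> s -` J)"
            using bij_betw_imp_inj_on [OF s] by (rule inj_on_subset) blast
          have "s ` (?N \<inter> s -` J) = s ` ?N \<inter> J"
            by blast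
          then show "s ` (?N \<inter> s -` J) = J"
            using bij_betw_imp_surj_on [OF s] J by (simp only: Int_absorb1)
        qed
      qed
      have "pos_lin_dep_family K (vdiag G xbar Ebar) \<longleftrightarrow>
          pos_lin_dep_family K (\<lambda>i. grad_g (s i) xbar)"
        using K(1) vbar by (intro pos_lin_dep_family_cong) blast
      also have "\<dots> \<longleftrightarrow> pos_lin_dep_family J (\<lambda>i. grad_g i xbar)"
        by (rule pos_lin_dep_family_reindex [OF K(2)])
      finally have "\<forall>\<^sub>F k in inf sequentially (principal I). lin_dep_family K (vdiag G (x k) (E k))"
        using IE K(1) pos by blast
      then have "\<forall>\<^sub>F k in ?F. lin_dep_family K (vdiag G (x k) (E k))"
        by (rule filter_leD [OF F(2)])
      moreover have "\<forall>\<^sub>F k in ?F. k \<in> I'"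
        by (simp add: eventually_inf_principal)
      ultimately have "\<forall>\<^sub>F k in ?F. k \<in> I' \<and> lin_dep_family K (vdiag G (x k) (E k))"
        by (simp add: eventually_conj_iff)
      \<comment> \<open>Since \<open>?F\<close> is nontrivial, one such \<open>k\<close> exists, and
        a single one contradicts \<open>indep\<close>.\<close>
      then obtain k where k: "k \<in> I'" "lin_dep_family K (vdiag G (x k) (E k))"
        using eventually_happens' [OF F(1)] by blast
      have "lin_dep_family K (vdiag G (x k) (E k)) \<longleftrightarrow>
          lin_dep_family K (\<lambda>i. grad_g (s i) (x k))"
        using K(1) v [OF k(1)] by (intro lin_dep_family_cong) blast
      also have "\<dots> \<longleftrightarrow> lin_dep_family J (\<lambda>i. grad_g i (x k))"
        by (rule lin_dep_family_reindex [OF K(2)])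
      finally show False
        using k(2) indep by blast
    qed
  next
    assume cpld: ?cpld
    have "\<exists>I E Ebar. infinite I \<and> (\<forall>k\<in>I. E k \<in> eigmats r (G (x k))) \<and>
        (\<forall>i\<in>?N. ((\<lambda>k. E k i) \<longlongrightarrow> Ebar i) (inf sequentially (principal I))) \<and>
        (\<forall>J\<subseteq>?N. pos_lin_dep_family J (vdiag G xbar Ebar) \<longrightarrow>
           (\<forall>\<^sub>F k in inf sequentially (principal I). lin_dep_family J (vdiag G (x k) (E k))))"
      if x: "x \<longlonglongrightarrow> xbar" for x
    proof -
      obtain I s where I: "infinite I" and s: "bij_betw s ?N ?A"
        and eig: "\<forall>k\<in>I. \<forall>i\<in>?N. eigval (G (x k)) (r + i) = g (s i) (x k)"
        unfolding G_def
        by (rule subsequence_with_constant_eigval_enumeration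
            [where g = g, OF cont assms(3) r_def x infinite_UNIV_nat]) blast
      \<comment> \<open>With the enumeration fixed on \<open>I\<close>, the same basis vectors serve
        for every \<open>k\<close>. The sequence of matrices is constant, and \<open>E\<close> is
        also its limit.\<close>
      define E :: "nat \<Rightarrow> real ^ 'm" where "E = (\<lambda>i. axis (s i) 1)"
      have "E \<in> eigmats r (G (x k))" if "k \<in> I" for k
      proof -
        have "E i \<bullet> E j = (if i = j then 1 else 0)" if "i \<in> ?N" "j \<in> ?N" for i j
          using inj_on_eq_iff [OF bij_betw_imp_inj_on [OF s] that]
          by (simp add: E_def inner_axis_axis)
        moreover have "G (x k) *v E i = eigval (G (x k)) (r + i) *\<^sub>R E i" if "i \<in> ?N" for i
          using bspec [OF bspec [OF eig \<open>k \<in> I\<close>] that]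
          by (simp add: E_def G_def diag_matrix_mult_vec vec_eq_iff axis_def)
        ultimately show ?thesis
          by (simp add: eigmats_def)
      qed
      \<comment> \<open>This holds at every \<open>y\<close>, so dependence near \<open>xbar\<close>
        can be pulled back along the sequence \<open>x\<close>.\<close>
      moreover have v: "vdiag G y E i = grad_g (s i) y" for y i
      proof -
        have "(E i $ j)\<^sup>2 *\<^sub>R grad_g j y = (if j = s i then grad_g j y else 0)" for j
          by (simp add: E_def axis_def)
        then show ?thesis
          by (simp add: vdiag)
      qed
      have "\<forall>\<^sub>F k in inf sequentially (principal I). lin_dep_family J (vdiag G (x k) E)"
        if J: "J \<subseteq> ?N" and pos: "pos_lin_dep_family J (vdiag G xbar E)" for J
      proof -
        have bij: "bij_betw s J (s ` J)"
          using s J by (auto simp: bij_betw_def intro: inj_on_subset)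
        have "s ` J \<subseteq> ?A"
          using s J by (auto simp: bij_betw_def)
        moreover have "pos_lin_dep_family (s ` J) (\<lambda>i. grad_g i xbar)"
          using pos pos_lin_dep_family_reindex [OF bij, of "\<lambda>i. grad_g i xbar"] by (simp add: v [abs_def])
        ultimately have "\<forall>\<^sub>F y in nhds xbar. lin_dep_family (s ` J) (\<lambda>i. grad_g i y)"
          using cpld by blast
        then have "\<forall>\<^sub>F y in nhds xbar. lin_dep_family J (vdiag G y E)"
          by (rule eventually_mono)
            (simp add: v [abs_def] lin_dep_family_reindex [OF bij, of "\<lambda>i. grad_g i _"])
        then have "\<forall>\<^sub>F k in sequentially. lin_dep_family J (vdiag G (x k) E)"
          using x by (rule eventually_compose_filterlim)
        then show ?thesis
          by (rule filter_leD [OF inf_le1])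
      qed
      ultimately show ?thesis
        using I by (intro exI [of _ I] exI [of _ "\<lambda>_. E"] exI [of _ E] conjI ballI allI impI
            tendsto_const)
    qed
    then show "weak_CPLD G xbar"
      unfolding weak_CPLD_def rank Let_def
      using psd_diag_matrix [of "\<lambda>i. g i xbar", OF assms(3)]
      by (intro conjI disjI2) (simp add: G_def, blast)
  qed
  then show ?thesis
    by (simp add: G_def)
qed

end
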